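(* For all odd $n = 2m+1$ there exist shorthand universal tori of the permutations of $\{0,1,\ldots,n-1\}$ of size $2$-by-$\frac{n!}{2}$ with $2$-by-$m$ windows which, moreover, partition into $2^{m-1}$ matching blocks.
   Context: Shorthand universal torus: let $[n]=\{0,1,\ldots,n-1\}$ and let $S_{n-1}(n)$ be the set of $(n-1)$-permutations of $[n]$, i.e. words of length $n-1$ with pairwise distinct entries in $[n]$ (each encodes a unique permutation of $[n]$ by appending its missing symbol). Given $R\cdot C = n!$ and $r \cdot c = n-1$, an $R$-by-$C$ shorthand universal torus of the permutations of $[n]$ with $r$-by-$c$ windows is an $R$-by-$C$ toroidal grid with entries in $[n]$ (row and column indices taken modulo $R$ and $C$) such that for every word in $S_{n-1}(n)$ there is exactly one position $(i,j)$ for which the window with top-left corner $(i,j)$, consisting of the cells $(i+a, j+b)$ with $0\le a<r$, $0\le b<c$, spells this word when read in row-major order. (When $R=r=2$, with rows indexed $0$ and $1$, the window with top row $i=1$ has its second row wrap around to row $0$.) Degenerate case: for $n=1$ (that is, $m=0$) the sizes in the claim are not integers, and the claim is understood by convention as being satisfied by the trivial empty torus; the substantive content is for odd $n\ge 3$. Matching blocks: a block of length $k$ is a run of $k$ contiguous columns. Two columns match if they contain the same unordered set of values; two blocks of the same length match if their columns match pairwise (first with first, second with second, and so on). The torus partitions into $2^{m-1}$ matching blocks if its columns can be cut into $2^{m-1}$ consecutive blocks of equal length $\frac{n!}{2^m}$ such that any two of the blocks match. *)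

theory Defs
  imports Main
begin

definition shorthand_perms :: "nat \<Rightarrow> nat list set" where
  "shorthand_perms n = {w. length w = n - 1 \<and> distinct w \<and> set w \<subseteq> {..<n}}"

text \<open>A grid with \<open>R\<close> rows and \<open>C\<close> columns is a function \<open>T\<close>, used only at arguments
  \<open>i < R\<close> and \<open>j < C\<close>; its values elsewhere are irrelevant.\<close>

definition window ::
  "nat \<Rightarrow> nat \<Rightarrow> nat \<Rightarrow> nat \<Rightarrow> (nat \<Rightarrow> nat \<Rightarrow> nat) \<Rightarrow> nat \<Rightarrow> nat \<Rightarrow> nat list" where
  "window R C r c T i j =
     concat (map (\<lambda>a. map (\<lambda>b. T ((i + a) mod R) ((j + b) mod C)) [0..<c]) [0..<r])"

definition shorthand_universal_torus ::
  "nat \<Rightarrow> nat \<Rightarrow> nat \<Rightarrow> nat \<Rightarrow> nat \<Rightarrow> (nat \<Rightarrow> nat \<Rightarrow> nat) \<Rightarrow> bool" where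
  "shorthand_universal_torus n R C r c T \<longleftrightarrow>
     R * C = fact n \<and> r * c = n - 1 \<and>
     (\<forall>i<R. \<forall>j<C. T i j < n) \<and>
     (\<forall>w \<in> shorthand_perms n.
        \<exists>!p. p \<in> {..<R} \<times> {..<C} \<and> window R C r c T (fst p) (snd p) = w)"

definition columns_match :: "nat \<Rightarrow> (nat \<Rightarrow> nat \<Rightarrow> nat) \<Rightarrow> nat \<Rightarrow> nat \<Rightarrow> bool" where
  "columns_match R T j j' \<longleftrightarrow> (\<lambda>i. T i j) ` {..<R} = (\<lambda>i. T i j') ` {..<R}"

text \<open>A block of length \<open>k\<close> is given by the index \<open>p\<close> of its first column.\<close>

definition blocks_match ::
  "nat \<Rightarrow> nat \<Rightarrow> (nat \<Rightarrow> nat \<Rightarrow> nat) \<Rightarrow> nat \<Rightarrow> nat \<Rightarrow> nat \<Rightarrow> bool" where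
  "blocks_match R C T k p q \<longleftrightarrow>
     (\<forall>t<k. columns_match R T ((p + t) mod C) ((q + t) mod C))"

text \<open>\<open>N\<close> consecutive blocks of length \<open>k\<close>. The first cut is placed before column \<open>0\<close>. This loses
  no generality: if the blocks match for some position of the first cut, then the value sets of the
  columns are \<open>k\<close>-periodic around the torus, so they match for every position.\<close>

definition partitions_into_matching_blocks ::
  "nat \<Rightarrow> nat \<Rightarrow> nat \<Rightarrow> nat \<Rightarrow> (nat \<Rightarrow> nat \<Rightarrow> nat) \<Rightarrow> bool" where
  "partitions_into_matching_blocks R C N k T \<longleftrightarrow>
     N * k = C \<and> (\<forall>x<N. \<forall>y<N. blocks_match R C T k (x * k) (y * k))"

end

theory Submission
  imports Defs "Graph_Theory.Euler"
begin

text \<open>Every \<open>m\<close> consecutive columns of the torus show \<open>m\<close> disjoint ordered pairs from \<open>{..<n}\<close>, and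
  starting the window in row 1 reverses all of them. So choose first the unordered pairs and then
  their orientations. For the former, take an Euler circuit of the graph whose arcs are the
  \<open>L = n! / 2^m\<close> sequences of \<open>m\<close> disjoint unordered pairs; it yields a cyclic sequence of \<open>L\<close>
  pairs that shows each such sequence once, and this is laid out \<open>2^(m - 1)\<close> times. Up to
  reversal, the orientations in a window are given by its \<open>q = m - 1\<close> orientation changes, so over
  the copies these must run through all binary words of length \<open>q\<close>. The \<open>k\<close>-th copy repeats the
  binary digits of \<open>k\<close> periodically, which fits because \<open>q\<close> divides \<open>L\<close>; since \<open>L\<close> is even, the
  total number of changes is even and the orientations close up without a twist. (For \<open>m = 1\<close>
  there are no changes to prescribe.)\<close>

subsection \<open>Sequences of disjoint pairs\<close>

text \<open>Since pairs are nonempty and \<open>sorted_wrt\<close> compares positions,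
  \<open>sorted_wrt disjnt\<close> also excludes repeated pairs.\<close>

definition pair_seqs :: "nat set \<Rightarrow> nat \<Rightarrow> nat set list set" where
  "pair_seqs V k = {ps. length ps = k \<and> (\<forall>p\<in>set ps. p \<subseteq> V \<and> card p = 2) \<and> sorted_wrt disjnt ps}"

lemma pair_seqs_Cons_iff:
  "p # ps \<in> pair_seqs V (Suc k) \<longleftrightarrow>
     ps \<in> pair_seqs V k \<and> p \<subseteq> V - \<Union>(set ps) \<and> card p = 2"
  by (auto simp: pair_seqs_def disjnt_def)

lemma pair_seqs_middle_iff:
  "xs @ p # ys \<in> pair_seqs V (Suc k) \<longleftrightarrow>
     xs @ ys \<in> pair_seqs V k \<and> p \<subseteq> V - \<Union>(set (xs @ ys)) \<and> card p = 2"
proof -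
  have "p \<subseteq> V - \<Union>(set (xs @ ys)) \<longleftrightarrow>
      p \<subseteq> V \<and> (\<forall>x\<in>set xs. disjnt x p) \<and> (\<forall>y\<in>set ys. disjnt p y)"
    by (auto simp: disjnt_iff)
  then show ?thesis
    by (auto simp only: pair_seqs_def sorted_wrt_append sorted_wrt.simps mem_Collect_eq length_append list.size
        set_append list.set ball_Un ball_simps Un_iff insert_iff simp_thms add_Suc_right nat.inject add_0_right)
qed

lemma pair_seqs_append_commute: "xs @ ys \<in> pair_seqs V k \<longleftrightarrow> ys @ xs \<in> pair_seqs V k"
  by (auto simp: pair_seqs_def sorted_wrt_append intro: disjnt_sym)

lemma pair_seqs_0: "pair_seqs V 0 = {[]}"
  by (auto simp: pair_seqs_def)

lemma finite_pair_seqs: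
  assumes "finite V"
  shows "finite (pair_seqs V k)"
proof (rule finite_subset)
  show "pair_seqs V k \<subseteq> {ps. set ps \<subseteq> Pow V \<and> length ps = k}"
    by (auto simp: pair_seqs_def)
  show "finite {ps. set ps \<subseteq> Pow V \<and> length ps = k}"
    using assms by (intro finite_lists_length_eq) auto
qed

lemma Union_pair_seqs:
  assumes "ps \<in> pair_seqs V k"
  shows "\<Union>(set ps) \<subseteq> V"
  using assms by (auto simp: pair_seqs_def)

lemma card_Union_pair_seqs:
  assumes "ps \<in> pair_seqs V k" "finite V"
  shows "card (\<Union>(set ps)) = 2 * k"
  using assms
proof (induction ps arbitrary: k)
  case Nil
  then show ?case by (auto simp: pair_seqs_def)
next
  case (Cons p ps)
  then obtain k' where k: "k = Suc k'" by (cases k) (auto simp: pair_seqs_def)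
  with Cons.prems have ps: "ps \<in> pair_seqs V k'" and p: "p \<subseteq> V - \<Union>(set ps)" "card p = 2"
    by (auto simp: pair_seqs_Cons_iff)
  have "finite (\<Union>(set ps))" "finite p"
    using Union_pair_seqs[OF ps] p \<open>finite V\<close> by (auto intro: finite_subset)
  then have "card (p \<union> \<Union>(set ps)) = card p + card (\<Union>(set ps))"
    using p by (intro card_Un_disjoint) auto
  with Cons.IH[OF ps \<open>finite V\<close>] p k show ?case by simp
qed

lemma card_free:
  assumes "ps \<in> pair_seqs V k" "finite V"
  shows "card (V - \<Union>(set ps)) = card V - 2 * k"
proof -
  have "finite (\<Union>(set ps))"
    by (rule finite_subset[OF Union_pair_seqs[OF assms(1)] assms(2)])
  then show ?thesis
    using card_Union_pair_seqs[OF assms] Union_pair_seqs[OF assms(1)] by (simp add: card_Diff_subset)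
qed

text \<open>A sequence of \<open>k\<close> pairs leaves \<open>r = card V - 2 * k\<close> symbols
  and extends by any of \<open>r choose 2\<close> pairs, half of \<open>r * (r - 1)\<close>, so the
  factorial telescopes. The case \<open>k = m\<close>, \<open>card V = 2 * m + 1\<close> gives
  \<open>n! = L * 2^m\<close>.\<close>

lemma card_pair_seqs:
  assumes "finite V" "2 * k \<le> card V"
  shows "card (pair_seqs V k) * 2 ^ k * fact (card V - 2 * k) = (fact (card V) :: nat)"
  using assms(2)
proof (induction k)
  case 0
  then show ?case by (simp add: pair_seqs_0)
next
  case (Suc k)
  define r where "r = card V - 2 * k"
  define s where "s = card V - 2 * Suc k"
  have r: "r = Suc (Suc s)" using Suc.prems r_def s_def by simp
  let ?F = "\<lambda>ps. {p. p \<subseteq> V - \<Union>(set ps) \<and> card p = 2}"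
  have eq: "pair_seqs V (Suc k) = (\<lambda>(ps, p). p # ps) ` (SIGMA ps : pair_seqs V k. ?F ps)"
  proof (intro set_eqI iffI)
    fix ps assume "ps \<in> pair_seqs V (Suc k)"
    moreover from this obtain p ps' where "ps = p # ps'"
      by (cases ps) (auto simp: pair_seqs_def)
    ultimately show "ps \<in> (\<lambda>(ps, p). p # ps) ` (SIGMA ps : pair_seqs V k. ?F ps)"
      by (auto simp: pair_seqs_Cons_iff image_iff)
  qed (auto simp: pair_seqs_Cons_iff)
  have fib: "card (?F ps) = r choose 2" if "ps \<in> pair_seqs V k" for ps
    using card_free[OF that assms(1)] assms(1) by (subst n_subsets) (auto simp: r_def)
  have "card (pair_seqs V (Suc k)) = card (SIGMA ps : pair_seqs V k. ?F ps)"
    unfolding eq by (intro card_image) (auto simp: inj_on_def)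
  also have "\<dots> = (\<Sum>ps\<in>pair_seqs V k. card (?F ps))"
    using assms(1) finite_pair_seqs by (intro card_SigmaI) auto
  also have "\<dots> = card (pair_seqs V k) * (r choose 2)"
    using fib by simp
  finally have c: "card (pair_seqs V (Suc k)) = card (pair_seqs V k) * (r choose 2)" .
  have two: "2 * (r choose 2) = r * (r - 1)"
    unfolding choose_two by (rule dvd_mult_div_cancel) (auto simp: r)
  have "fact r = r * (r - 1) * (fact s :: nat)"
    by (simp add: r algebra_simps)
  with two have "fact r = (2 * (r choose 2)) * (fact s :: nat)" by simp
  moreover have "card (pair_seqs V k) * 2 ^ k * fact r = (fact (card V) :: nat)"
    using Suc by (simp add: r_def)
  ultimately show ?case unfolding c s_def[symmetric] by (simp add: mult_ac)
qed

text \<open>In a sequence with one free symbol, rotating and then replacing the last pair swaps the free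
  symbol with a symbol of any chosen pair. Such swaps turn the pairs of \<open>ps\<close> into those of \<open>qs\<close>
  from left to right.\<close>

lemma swap_invariant_const:
  fixes g :: "nat set list \<Rightarrow> 'b"
  assumes V: "finite V" "card V = 2 * m + 1"
    and rot: "\<And>p ps. p # ps \<in> pair_seqs V m \<Longrightarrow> g (ps @ [p]) = g (p # ps)"
    and upd: "\<And>ps p q. ps @ [p] \<in> pair_seqs V m \<Longrightarrow> ps @ [q] \<in> pair_seqs V m \<Longrightarrow> g (ps @ [p]) = g (ps @ [q])"
    and ps: "ps \<in> pair_seqs V m" "qs \<in> pair_seqs V m"
  shows "g ps = g qs"
proof -
  have rots: "g (ys @ xs) = g (xs @ ys)" if "xs @ ys \<in> pair_seqs V m" for xs ys
    using that
  proof (induction xs arbitrary: ys)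
    case (Cons x xs)
    then have "xs @ (ys @ [x]) \<in> pair_seqs V m"
      using pair_seqs_append_commute[of "[x]" "xs @ ys"] by simp
    from Cons.IH[OF this] rot[of x "xs @ ys"] Cons.prems show ?case by simp
  qed simp
  \<comment> \<open>Rotate until the changed pair is last, replace it, and rotate back.\<close>
  have change: "g (xs @ p # ys) = g (xs @ q # ys)"
    if "xs @ p # ys \<in> pair_seqs V m" "xs @ q # ys \<in> pair_seqs V m" for xs ys p q
    using rots[of "xs @ [p]" ys] rots[of "xs @ [q]" ys] upd[of "ys @ xs" p q] that
      pair_seqs_append_commute[of "xs @ [p]" ys] pair_seqs_append_commute[of "xs @ [q]" ys] by simp
  \<comment> \<open>If \<open>c\<close> lies in a pair \<open>{c, e}\<close> after the fixed prefix,
    that pair is traded for \<open>{z, e}\<close>, with \<open>z\<close> the only free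
    symbol.\<close>
  have free: "\<exists>ys'. xs @ ys' \<in> pair_seqs V m \<and> g (xs @ ys') = g (xs @ ys) \<and> c \<notin> \<Union>(set (xs @ ys'))"
    if A: "xs @ ys \<in> pair_seqs V m" and c: "c \<notin> \<Union>(set xs)" for xs ys c
  proof (cases "c \<in> \<Union>(set ys)")
    case False
    with A c show ?thesis by auto
  next
    case True
    then obtain us p vs where ys: "ys = us @ p # vs" and cp: "c \<in> p"
      by (auto dest: split_list)
    obtain m' where m: "m = Suc m'" using A ys by (cases m) (auto simp: pair_seqs_def)
    have A': "(xs @ us) @ vs \<in> pair_seqs V m'" "p \<subseteq> V - \<Union>(set ((xs @ us) @ vs))" "card p = 2"
      using A pair_seqs_middle_iff[of "xs @ us" p vs V m'] by (simp_all add: ys m)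
    have "card (V - \<Union>(set (xs @ ys))) = 1"
      using card_free[OF A V(1)] V(2) by simp
    then obtain z where z: "z \<in> V - \<Union>(set (xs @ ys))"
      by (metis One_nat_def card_1_singletonE singletonI)
    obtain e where e: "p = {c, e}" "c \<noteq> e"
      using A'(3) cp by (auto simp: card_2_iff)
    have B: "(xs @ us) @ {z, e} # vs \<in> pair_seqs V m"
      unfolding m pair_seqs_middle_iff using A' z e by (auto simp: ys)
    have "g ((xs @ us) @ {z, e} # vs) = g ((xs @ us) @ p # vs)"
      using A B by (intro change) (simp_all add: ys)
    moreover have "c \<notin> \<Union>(set ((xs @ us) @ {z, e} # vs))"
      using z e A' by (auto simp: ys)
    ultimately show ?thesis
      using B by (intro exI[of _ "us @ {z, e} # vs"]) (auto simp: ys)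
  qed
  \<comment> \<open>To place \<open>q = {c, d}\<close> after \<open>xs\<close>: free
    \<open>c\<close>, put it into the pair \<open>b\<close> now standing there, giving
    \<open>{c, b1}\<close>; unless \<open>d = b1\<close>, free \<open>d\<close> while keeping
    \<open>{c, b1}\<close> fixed, and trade \<open>b1\<close> for \<open>d\<close>.\<close>
  have fill: "\<exists>ys'. xs @ q # ys' \<in> pair_seqs V m \<and> g (xs @ q # ys') = g (xs @ p # ys)"
    if A: "xs @ p # ys \<in> pair_seqs V m" and Q: "xs @ q # zs \<in> pair_seqs V m" for xs p q ys zs
  proof -
    obtain m' where m: "m = Suc m'" using A by (cases m) (auto simp: pair_seqs_def)
    have q: "q \<subseteq> V - \<Union>(set xs)" "card q = 2"
      using Q unfolding m pair_seqs_middle_iff by auto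
    then obtain c d where cd: "q = {c, d}" "c \<noteq> d" by (auto simp: card_2_iff)
    obtain ys0 where ys0: "xs @ ys0 \<in> pair_seqs V m" "g (xs @ ys0) = g (xs @ p # ys)"
      "c \<notin> \<Union>(set (xs @ ys0))"
      using free[OF A, of c] q cd by auto
    have "length ys0 = Suc (length ys)"
      using ys0(1) A by (simp add: pair_seqs_def)
    then obtain b ys1 where b: "ys0 = b # ys1" by (cases ys0) auto
    have b2: "xs @ ys1 \<in> pair_seqs V m'" "b \<subseteq> V - \<Union>(set (xs @ ys1))" "card b = 2"
      using ys0(1) unfolding b m pair_seqs_middle_iff by auto
    then obtain b1 where b1: "b1 \<in> b" by (metis card.empty equals0I zero_neq_numeral)
    have c1: "xs @ {c, b1} # ys1 \<in> pair_seqs V m"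
      unfolding m pair_seqs_middle_iff using b2 b1 ys0(3) q cd by (auto simp: b card_2_iff)
    have g1: "g (xs @ {c, b1} # ys1) = g (xs @ p # ys)"
      using change[OF c1, of b] ys0 b by simp
    show ?thesis
    proof (cases "d = b1")
      case True
      then show ?thesis using c1 g1 cd by auto
    next
      case False
      then have "d \<notin> \<Union>(set (xs @ [{c, b1}]))" using q cd by auto
      with free[of "xs @ [{c, b1}]" ys1 d] c1 obtain ys2 where
        ys2: "xs @ {c, b1} # ys2 \<in> pair_seqs V m" "g (xs @ {c, b1} # ys2) = g (xs @ {c, b1} # ys1)"
        "d \<notin> \<Union>(set (xs @ {c, b1} # ys2))" by auto
      have c3: "xs @ q # ys2 \<in> pair_seqs V m"
        using ys2 q unfolding m pair_seqs_middle_iff by (auto simp: cd)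
      with change[OF this ys2(1)] ys2(2) g1 show ?thesis by auto
    qed
  qed
  have "g (xs @ ys) = g (xs @ zs)"
    if "xs @ ys \<in> pair_seqs V m" "xs @ zs \<in> pair_seqs V m" for xs ys zs
    using that
  proof (induction zs arbitrary: xs ys)
    case Nil
    then have "ys = []" by (simp add: pair_seqs_def)
    then show ?case by simp
  next
    case (Cons q zs)
    then obtain p ys' where ys: "ys = p # ys'"
      by (cases ys) (auto simp: pair_seqs_def)
    from fill[of xs p ys' q zs] Cons.prems obtain ys2 where
      "xs @ q # ys2 \<in> pair_seqs V m" "g (xs @ q # ys2) = g (xs @ p # ys')"
      by (auto simp: ys)
    with Cons.IH[of "xs @ [q]" ys2] Cons.prems(2) ys show ?case by simp
  qed
  from this[of "[]" ps qs] ps show ?thesis by simp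
qed

subsection \<open>A universal cycle\<close>

text \<open>An analogue of a de Bruijn graph: consecutive arcs of a walk overlap in
  \<open>m - 1\<close> pairs.\<close>

definition overlap_graph :: "nat set \<Rightarrow> nat \<Rightarrow> (nat set list, nat set list) pre_digraph" where
  "overlap_graph V m =
     \<lparr>verts = pair_seqs V (m - 1), arcs = pair_seqs V m, tail = butlast, head = tl\<rparr>"

text \<open>Rotation maps the arcs entering a vertex bijectively to those leaving it, so the graph
  is balanced. Its weak connectedness comes from \<open>swap_invariant_const\<close>.\<close>

lemma overlap_graph_euler:
  assumes V: "finite V" "card V = 2 * m + 1" and m: "m \<ge> 1"
  shows "\<exists>u p. pre_digraph.euler_trail (overlap_graph V m) u p u"
proof -
  let ?G = "overlap_graph V m"
  obtain m' where m': "m = Suc m'" using m by (cases m) auto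
  have sel: "verts ?G = pair_seqs V m'" "arcs ?G = pair_seqs V m" "tail ?G = butlast" "head ?G = tl"
    by (simp_all add: overlap_graph_def m')
  have tail: "butlast ps \<in> pair_seqs V m'" if "ps \<in> pair_seqs V m" for ps
    using that pair_seqs_middle_iff[of "butlast ps" "last ps" "[]" V m']
    by (cases "ps = []") (auto simp: m' pair_seqs_def)
  have head: "tl ps \<in> pair_seqs V m'" if "ps \<in> pair_seqs V m" for ps
    using that by (cases ps) (auto simp: m' pair_seqs_Cons_iff, auto simp: pair_seqs_def)
  interpret G: fin_digraph ?G
    by unfold_locales (auto simp: sel tail head finite_pair_seqs V)
  interpret S: pair_fin_digraph "mk_symmetric ?G" ..
  \<comment> \<open>The component of the tail of \<open>ps\<close>. Replacing the last pair keeps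
    the tail, so only rotation needs an argument.\<close>
  define g where "g ps = {v. butlast ps \<rightarrow>\<^sup>*\<^bsub>mk_symmetric ?G\<^esub> v}" for ps
  \<comment> \<open>Every vertex is the tail of an arc, so constancy of \<open>g\<close> on arcs
    reaches all vertices.\<close>
  have extend: "\<exists>x. u @ [x] \<in> pair_seqs V m" if u: "u \<in> pair_seqs V m'" for u
  proof -
    have "2 \<le> card (V - \<Union>(set u))" using card_free[OF u V(1)] V(2) m' by simp
    then obtain x where "x \<subseteq> V - \<Union>(set u)" "card x = 2"
      by (rule obtain_subset_with_card_n)
    with u have "u @ [x] \<in> pair_seqs V m"
      unfolding m' pair_seqs_middle_iff by auto
    then show ?thesis ..
  qed
  have sym: "(u \<rightarrow>\<^sup>*\<^bsub>mk_symmetric ?G\<^esub> v) = (v \<rightarrow>\<^sup>*\<^bsub>mk_symmetric ?G\<^esub> u)" for u v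
    by (rule iffI; rule symmetric_reachable[OF symmetric_mk_symmetric])
  \<comment> \<open>The head of an arc is the tail of its rotation.\<close>
  have rot: "g (ps @ [p]) = g (p # ps)" if "p # ps \<in> pair_seqs V m" for p ps
  proof -
    have "butlast (p # ps) \<rightarrow>\<^bsub>mk_symmetric ?G\<^esub> ps"
      using that by (force simp: parcs_mk_symmetric sel)
    then have "butlast (p # ps) \<rightarrow>\<^sup>*\<^bsub>mk_symmetric ?G\<^esub> ps"
      by (intro wf_digraph.reachable_adjI S.wf_digraph)
    with sym have "butlast (p # ps) \<rightarrow>\<^sup>*\<^bsub>mk_symmetric ?G\<^esub> v \<longleftrightarrow> ps \<rightarrow>\<^sup>*\<^bsub>mk_symmetric ?G\<^esub> v" for v
      by (meson S.reachable_trans)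
    then show ?thesis
      by (simp add: g_def set_eq_iff del: butlast.simps)
  qed
  have const: "g ps = g qs" if "ps \<in> pair_seqs V m" "qs \<in> pair_seqs V m" for ps qs
    by (rule swap_invariant_const[OF V rot _ that]) (simp_all add: g_def)
  have con: "connected ?G"
  proof (rule G.connectedI)
    show "verts ?G \<noteq> {}"
    proof -
      have "card (pair_seqs V m') * 2 ^ m' * fact (card V - 2 * m') \<noteq> (0 :: nat)"
        using card_pair_seqs[OF V(1), of m'] V(2) m' by simp
      then show ?thesis by (auto simp: sel)
    qed
  next
    fix u v assume u: "u \<in> verts ?G" and v: "v \<in> verts ?G"
    obtain x y where "u @ [x] \<in> pair_seqs V m" "v @ [y] \<in> pair_seqs V m"
      using extend u v sel by metis
    then have "g (u @ [x]) = g (v @ [y])" by (rule const)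
    moreover have "v \<in> g (v @ [y])" using v by (simp add: g_def)
    ultimately show "u \<rightarrow>\<^sup>*\<^bsub>mk_symmetric ?G\<^esub> v" by (auto simp: g_def)
  qed
  have deg: "in_degree ?G u = out_degree ?G u" if "u \<in> verts ?G" for u
  proof -
    have "bij_betw rotate1 (in_arcs ?G u) (out_arcs ?G u)"
      unfolding in_arcs_def out_arcs_def sel
    proof (rule bij_betwI[where g = "\<lambda>ps. last ps # butlast ps"]; safe)
      fix ps assume ps: "ps \<in> pair_seqs V m"
      then obtain p ps' where [simp]: "ps = p # ps'" by (cases ps) (auto simp: m' pair_seqs_def)
      show "rotate1 ps \<in> pair_seqs V m"
        using ps pair_seqs_append_commute[of "[p]" ps'] by simp
      show "butlast (rotate1 ps) = tl ps" by simp
      show "last (rotate1 ps) # butlast (rotate1 ps) = ps" by simp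
    next
      fix ps assume ps: "ps \<in> pair_seqs V m"
      then obtain p ps' where [simp]: "ps = ps' @ [p]"
        by (cases ps rule: rev_cases) (auto simp: m' pair_seqs_def)
      show "last ps # butlast ps \<in> pair_seqs V m"
        using ps pair_seqs_append_commute[of "[p]" ps'] by simp
      show "tl (last ps # butlast ps) = butlast ps" by simp
      show "rotate1 (last ps # butlast ps) = ps" by simp
    qed
    then show ?thesis
      unfolding in_degree_def out_degree_def by (rule bij_betw_same_card)
  qed
  from G.closed_euler1[OF con deg] show ?thesis by blast
qed

text \<open>With \<open>cas_tail_first\<close>, this lets a closed walk be read cyclically.\<close>

lemma cas_nth:
  assumes "pre_digraph.cas G u p v" "i < length p"
  shows "head G (p ! i) = (if Suc i < length p then tail G (p ! Suc i) else v)"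
  using assms
proof (induction p arbitrary: u i)
  case (Cons e es)
  then show ?case
    by (cases i; cases es) (auto simp: pre_digraph.cas.simps)
qed simp

lemma cas_tail_first:
  assumes "pre_digraph.cas G u p v" "p \<noteq> []"
  shows "tail G (p ! 0) = u"
  using assms by (cases p) (auto simp: pre_digraph.cas.simps)

text \<open>Let \<open>P j\<close> be the first pair of the \<open>j\<close>-th arc of an Euler
  circuit. By the overlaps, the window of \<open>P\<close> at \<open>j\<close> is that whole arc,
  and the circuit uses each arc once.\<close>

lemma universal_cycle_pair_seqs:
  assumes V: "finite V" "card V = 2 * m + 1" and m: "m \<ge> 1"
  defines "L \<equiv> card (pair_seqs V m)"
  obtains P :: "nat \<Rightarrow> nat set"
  where "\<And>j. P (j mod L) = P j"
    and "bij_betw (\<lambda>j. map (\<lambda>b. P (j + b)) [0..<m]) {..<L} (pair_seqs V m)"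
proof -
  let ?G = "overlap_graph V m"
  obtain u p where p: "pre_digraph.euler_trail ?G u p u"
    using overlap_graph_euler[OF V m] by blast
  have set: "set p = pair_seqs V m" and dist: "distinct p" and cas: "pre_digraph.cas ?G u p u"
    using p by (auto simp: pre_digraph.euler_trail_def pre_digraph.trail_def pre_digraph.awalk_def
        overlap_graph_def)
  have len: "length p = L"
    using set dist distinct_card L_def by metis
  have "card (pair_seqs V m) * 2 ^ m * fact (card V - 2 * m) \<noteq> (0 :: nat)"
    using card_pair_seqs[OF V(1), of m] V(2) by simp
  then have L0: "L > 0" by (simp add: L_def)
  define Q where "Q j = p ! (j mod L)" for j
  have Qin: "Q j \<in> pair_seqs V m" for j
    unfolding Q_def set[symmetric] using L0 len by (intro nth_mem) simp
  have lenQ: "length (Q j) = m" for j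
    using Qin[of j] by (simp add: pair_seqs_def)
  have step: "tl (Q j) = butlast (Q (Suc j))" for j
  proof -
    have j: "j mod L < length p" using L0 len by simp
    then have "Suc (j mod L) < L \<or> Suc (j mod L) = L" using len by linarith
    with cas_nth[OF cas j] cas_tail_first[OF cas] L0 len show ?thesis
      by (auto simp: Q_def overlap_graph_def mod_Suc)
  qed
  have nth: "Q (Suc j) ! b = Q j ! Suc b" if "Suc b < m" for j b
    using arg_cong[OF step[of j], of "\<lambda>xs. xs ! b"] that lenQ by (simp add: nth_tl nth_butlast)
  define P where "P j = Q j ! 0" for j
  have QP: "Q j ! b = P (j + b)" if "b < m" for j b
    using that
  proof (induction b arbitrary: j)
    case (Suc b)
    then show ?case using nth[of b j] Suc.IH[of "Suc j"] by simp
  qed (simp add: P_def)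
  have win: "map (\<lambda>b. P (j + b)) [0..<m] = Q j" for j
    by (rule nth_equalityI) (auto simp: lenQ QP)
  show thesis
  proof
    show "P (j mod L) = P j" for j by (simp add: P_def Q_def)
    have "bij_betw (\<lambda>j. p ! j) {..<L} (pair_seqs V m)"
      using bij_betw_nth[OF dist] len set by auto
    then show "bij_betw (\<lambda>j. map (\<lambda>b. P (j + b)) [0..<m]) {..<L} (pair_seqs V m)"
      unfolding win by (rule bij_betw_cong[THEN iffD1, rotated]) (simp add: Q_def)
  qed
qed

subsection \<open>Orientations of the pairs\<close>

text \<open>The base-2 digits of the row number \<open>j div L\<close>, repeated with period \<open>q\<close> along the row, say
  whether the orientation changes between columns \<open>j\<close> and \<open>j + 1\<close>.\<close>

definition flip :: "nat \<Rightarrow> nat \<Rightarrow> nat \<Rightarrow> bool" where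
  "flip q L j \<longleftrightarrow> bit (j div L) (j mod q)"

text \<open>The changes before column \<open>j\<close> are counted; only the parity of the count
  will matter.\<close>

definition orient :: "nat \<Rightarrow> nat \<Rightarrow> nat \<Rightarrow> nat" where
  "orient q L j = (\<Sum>i<j. of_bool (flip q L i))"

lemma bit_add_multiple:
  fixes k c q r :: nat
  assumes "r < q"
  shows "bit (k + 2 ^ q * c) r \<longleftrightarrow> bit k r"
proof -
  have "(2 :: nat) ^ q = 2 ^ r * (2 * 2 ^ (q - Suc r))"
    using assms by (metis Suc_diff_Suc add_diff_inverse_nat not_less_iff_gr_or_eq power_Suc power_add)
  then have "(k + 2 ^ q * c) div 2 ^ r = k div 2 ^ r + 2 * (2 ^ (q - Suc r) * c)"
    by (simp add: mult.assoc)
  then show ?thesis by (simp add: bit_iff_odd)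
qed

lemma sum_lessThan_add:
  fixes f :: "nat \<Rightarrow> nat"
  shows "sum f {..<a + b} = sum f {..<a} + (\<Sum>i<b. f (a + i))"
  by (induction b) simp_all

text \<open>Half of the numbers have digit \<open>r\<close> set: the upper half of the range repeats
  the digits of the lower half, except for the top digit, which is 0 below and 1 above.\<close>

lemma sum_bit:
  assumes "r < q"
  shows "(\<Sum>k\<in>{..<2 ^ q :: nat}. of_bool (bit k r) :: nat) = 2 ^ (q - 1)"
  using assms
proof (induction q)
  case (Suc q)
  let ?f = "\<lambda>k :: nat. of_bool (bit k r) :: nat"
  have split: "sum ?f {..<2 ^ Suc q} = sum ?f {..<2 ^ q} + (\<Sum>k<2 ^ q. ?f (2 ^ q + k))"
    using sum_lessThan_add[of ?f "2 ^ q" "2 ^ q"] by (simp add: mult_2)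
  show ?case
  proof (cases "r = q")
    case True
    have "?f k = 0" "?f (2 ^ q + k) = 1" if "k < 2 ^ q" for k
      using that by (simp_all add: True bit_iff_odd)
    then show ?thesis unfolding split by simp
  next
    case False
    then have r: "r < q" using Suc.prems by simp
    have "?f (2 ^ q + k) = ?f k" for k
      using bit_add_multiple[OF r, of k 1] by (simp add: add.commute)
    then have "sum ?f {..<2 ^ Suc q} = 2 * 2 ^ (q - 1)"
      unfolding split using Suc.IH[OF r] by simp
    also have "\<dots> = 2 ^ q" using r by (cases q) simp_all
    finally show ?thesis by simp
  qed
qed simp

text \<open>Summing over the copies first, \<open>sum_bit\<close> gives \<open>2 ^ (q - 1)\<close>
  changes at each of the \<open>L\<close> positions. For \<open>q = 1\<close> only the factor
  \<open>L\<close> can make the total even.\<close>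

lemma orient_period:
  assumes q: "q > 0" "q dvd L" and L: "L > 0"
  shows "orient q L (2 ^ q * L) = L * 2 ^ (q - 1)"
proof -
  let ?f = "\<lambda>i. of_bool (flip q L i) :: nat"
  have f: "?f (t + k * L) = of_bool (bit k (t mod q))" if "t < L" for t k
  proof -
    have "(t + k * L) mod q = t mod q"
      using q(2) by (metis dvd_mult mod_add_right_eq mod_0_imp_dvd dvd_imp_mod_0 add_0_right)
    moreover have "(t + k * L) div L = k" using that by simp
    ultimately show ?thesis by (simp add: flip_def)
  qed
  have "orient q L (2 ^ q * L) = (\<Sum>k<2 ^ q. sum ?f {k * L..<k * L + L})"
    unfolding orient_def by (rule sum.nat_group[symmetric])
  also have "\<dots> = (\<Sum>k<2 ^ q. \<Sum>t<L. ?f (t + k * L))"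
  proof (rule sum.cong[OF refl])
    show "sum ?f {k * L..<k * L + L} = (\<Sum>t<L. ?f (t + k * L))" for k
      using sum.shift_bounds_nat_ivl[of ?f 0 "k * L" L]
      unfolding lessThan_atLeast0 by (simp only: add_0_left add.commute[of L])
  qed
  also have "\<dots> = (\<Sum>k\<in>{..<2 ^ q :: nat}. \<Sum>t<L. of_bool (bit k (t mod q)))"
    by (intro sum.cong refl) (auto simp: f)
  also have "\<dots> = (\<Sum>t<L. \<Sum>k\<in>{..<2 ^ q :: nat}. of_bool (bit k (t mod q)))"
    by (rule sum.swap)
  also have "\<dots> = (\<Sum>t<L. 2 ^ (q - 1))"
    using q(1) by (intro sum.cong refl sum_bit) simp
  finally show ?thesis by simp
qed

text \<open>A full turn adds \<open>2 ^ q\<close> to the copy number, which leaves the digits below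
  \<open>q\<close> alone.\<close>

lemma flip_periodic:
  assumes q: "q > 0" "q dvd L" and L: "L > 0"
  shows "flip q L (2 ^ q * L + j) \<longleftrightarrow> flip q L j"
proof -
  have "(2 ^ q * L + j) div L = j div L + 2 ^ q * 1" using L by simp
  moreover have "(2 ^ q * L + j) mod q = j mod q"
    using q(2) by (metis dvd_mult mod_add_left_eq dvd_imp_mod_0 add_0_left)
  ultimately show ?thesis
    using q(1) unfolding flip_def by (simp only: bit_add_multiple mod_less_divisor)
qed

text \<open>Each full turn contributes an even number of changes, so the orientations close
  up.\<close>

lemma even_orient_mod:
  assumes q: "q > 0" "q dvd L" and L: "L > 0" "even L"
  shows "even (orient q L (j mod (2 ^ q * L))) \<longleftrightarrow> even (orient q L j)"
proof (induction j rule: less_induct)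
  case (less j)
  let ?C = "2 ^ q * L"
  show ?case
  proof (cases "j < ?C")
    case False
    then have j: "j = ?C + (j - ?C)" by simp
    have "orient q L (?C + (j - ?C)) = orient q L ?C + orient q L (j - ?C)"
      unfolding orient_def sum_lessThan_add using flip_periodic[OF q L(1)] by simp
    then have "orient q L j = orient q L ?C + orient q L (j - ?C)"
      using j by simp
    moreover have "even (orient q L ?C)"
      using L(2) by (simp add: orient_period[OF q L(1)])
    moreover have "j - ?C < j"
    proof (rule diff_less)
      show "?C > 0" using L(1) by simp
      with False show "j > 0" by linarith
    qed
    moreover have "j mod ?C = (j - ?C) mod ?C" using False by (simp add: le_mod_geq)
    ultimately show ?thesis using less.IH[of "j - ?C"] by simp
  qed simp
qed

text \<open>The low digits make \<open>k + 1\<close> and \<open>k' + 1\<close> congruent modulo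
  \<open>2 ^ s\<close>; subtracting 1 shows that \<open>k\<close> and \<open>k'\<close> share their
  low digits too.\<close>

lemma bits_determine:
  fixes k k' q s :: nat
  assumes k: "k < 2 ^ q" "k' < 2 ^ q"
    and high: "\<And>r. s \<le> r \<Longrightarrow> r < q \<Longrightarrow> bit k r \<longleftrightarrow> bit k' r"
    and low: "\<And>r. r < s \<Longrightarrow> bit (k + 1) r \<longleftrightarrow> bit (k' + 1) r"
  shows "k = k'"
proof -
  have "take_bit s (k + 1) = take_bit s (k' + 1)"
    by (rule bit_eqI) (use low in \<open>auto simp: bit_take_bit_iff\<close>)
  then have "(k + 1) mod 2 ^ s = (k' + 1) mod 2 ^ s" by (simp add: take_bit_eq_mod)
  then have "take_bit s k = take_bit s k'"
    unfolding take_bit_eq_mod nat_mod_eq_iff by simp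
  then have low': "bit k r \<longleftrightarrow> bit k' r" if "r < s" for r
    using that by (metis bit_take_bit_iff)
  have "take_bit q k = take_bit q k'"
  proof (rule bit_eqI)
    fix r
    show "bit (take_bit q k) r \<longleftrightarrow> bit (take_bit q k') r"
      using high[of r] low'[of r] by (cases "r < s") (auto simp: bit_take_bit_iff)
  qed
  then show ?thesis using k by (simp add: take_bit_eq_mod)
qed

text \<open>A window of length \<open>q\<close> inside row \<open>k\<close> is a rotation of the digits of \<open>k\<close>. One that runs into
  the next row shows the high digits of \<open>k\<close> and the low digits of \<open>k + 1\<close>.\<close>

lemma flip_window_inj:
  assumes q: "q > 0" "q dvd L" and t: "t < L" and k: "k < 2 ^ q" "k' < 2 ^ q"
    and eq: "\<And>b. b < q \<Longrightarrow> flip q L (k * L + t + b) \<longleftrightarrow> flip q L (k' * L + t + b)"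
  shows "k = k'"
proof -
  have qL: "q \<le> L" using q t by (auto intro: dvd_imp_le)
  have md: "(x * L + y) mod q = y mod q" for x y
    using q(2) by (metis dvd_mult mod_add_left_eq dvd_imp_mod_0 add_0_left)
  have inside: "flip q L (x * L + t + b) \<longleftrightarrow> bit x ((t + b) mod q)" if "t + b < L" for x b
    using that md[of x "t + b"] by (simp add: flip_def add.assoc)
  show ?thesis
  proof (cases "t + q \<le> L")
    case True
    show ?thesis
    proof (rule bits_determine[OF k, of 0])
      fix r assume r: "r < q"
      \<comment> \<open>The solution of \<open>t + b = r\<close> modulo \<open>q\<close>: the offset
        at which digit \<open>r\<close> is shown.\<close>
      define b where "b = (r + (q - t mod q)) mod q"
      have b: "b < q" using q by (simp add: b_def)
      have "(t + b) mod q = (t mod q + (r + (q - t mod q))) mod q"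
        unfolding b_def by (simp add: mod_simps)
      also have "t mod q + (r + (q - t mod q)) = r + q"
        using mod_less_divisor[OF q(1), of t] by linarith
      finally have "(t + b) mod q = r" using r by simp
      with eq[OF b] inside[of b k] inside[of b k'] b True
      show "bit k r \<longleftrightarrow> bit k' r" by simp
    qed simp
  next
    case False
    \<comment> \<open>The number of window columns that fall into the next copy.\<close>
    define s where "s = t + q - L"
    have s: "s < q" "t + q = L + s" using t False by (auto simp: s_def)
    show ?thesis
    proof (rule bits_determine[OF k, of s])
      fix r assume r: "s \<le> r" "r < q"
      \<comment> \<open>As \<open>q\<close> divides \<open>L\<close>, the last \<open>q\<close>
        columns of a copy show the digits in order from 0, so this window starts at digit
        \<open>s\<close>.\<close>
      have tr: "t + (r - s) = (L - q) + r" using s r qL by linarith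
      have "(L - q) mod q = 0" using q(2) by (simp add: dvd_diff_nat)
      then have "((L - q) + r) mod q = r" using r by (metis add_0_left mod_add_left_eq mod_less)
      with tr have "(t + (r - s)) mod q = r" by simp
      moreover have "t + (r - s) < L" using tr r qL by linarith
      ultimately show "bit k r \<longleftrightarrow> bit k' r"
        using eq[of "r - s"] r inside[of "r - s" k] inside[of "r - s" k'] by simp
    next
      fix r assume r: "r < s"
      have wrap: "flip q L (x * L + t + (q - s + r)) \<longleftrightarrow> bit (x + 1) r" for x
      proof -
        have "x * L + t + (q - s + r) = (x + 1) * L + r" using s r by simp
        moreover have "((x + 1) * L + r) div L = x + 1" using r s qL by (intro div_nat_eqI) auto
        moreover have "((x + 1) * L + r) mod q = r" using md[of "x + 1" r] r s by simp
        ultimately show ?thesis unfolding flip_def by (simp only:)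
      qed
      show "bit (k + 1) r \<longleftrightarrow> bit (k' + 1) r"
        using eq[of "q - s + r"] wrap[of k] wrap[of k'] r s by simp
    qed
  qed
qed

section \<open>Divisibility and counting facts\<close>

text \<open>The factor \<open>2 * m + 2\<close> supplies both \<open>Suc m\<close> and a 2. With
  \<open>n! = L * 2^m\<close> it follows that \<open>m!\<close> divides \<open>L\<close>, hence so
  do \<open>q\<close>, and 2 if \<open>m\<close> is at least 2.\<close>

lemma fact_mult_power_two_dvd: "fact m * 2 ^ m dvd (fact (2 * m + 1) :: nat)"
proof (induction m)
  case (Suc m)
  then obtain K where K: "fact (2 * m + 1) = fact m * 2 ^ m * (K :: nat)" by (rule dvdE)
  have "fact (2 * Suc m + 1) = (2 * m + 3) * ((2 * m + 2) * fact (2 * m + 1) :: nat)"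
    by (simp add: algebra_simps)
  also have "\<dots> = (fact (Suc m) * 2 ^ Suc m) * ((2 * m + 3) * K)"
    unfolding K by (simp add: algebra_simps)
  finally show ?case by (metis dvd_triv_left)
qed simp

lemma card_two_Min_Max:
  fixes A :: "nat set"
  assumes "card A = 2"
  shows "Min A \<noteq> Max A" "A = {Min A, Max A}"
proof -
  obtain a b where "A = {a, b}" "a \<noteq> b" using assms by (auto simp: card_2_iff)
  then show "Min A \<noteq> Max A" "A = {Min A, Max A}" by (auto simp: min_def max_def)
qed

lemma card_shorthand_perms:
  assumes "n \<ge> 1"
  shows "card (shorthand_perms n) = fact n"
proof -
  have "card (shorthand_perms n) = \<Prod>{n - (n - 1) + 1..n}"
    unfolding shorthand_perms_def using card_lists_distinct_length_eq[of "{..<n}" "n - 1"] by simp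
  also have "\<dots> = \<Prod>{2..n}" using assms by (simp add: numeral_2_eq_2)
  also have "\<dots> = \<Prod>{1..n}"
    using assms by (simp add: prod.atLeast_Suc_atMost numeral_2_eq_2)
  finally show ?thesis by (simp add: fact_prod)
qed

subsection \<open>The torus\<close>

theorem theorem1:
  fixes n m :: nat
  assumes "n = 2 * m + 1" and "m \<ge> 1"
  shows "\<exists>T. shorthand_universal_torus n 2 (fact n div 2) 2 m T \<and>
             partitions_into_matching_blocks 2 (fact n div 2) (2 ^ (m - 1)) (fact n div 2 ^ m) T"
proof -
  let ?V = "{..<n}"
  define L where "L = card (pair_seqs ?V m)"
  define q where "q = m - 1"
  define C where "C = 2 ^ q * L"
  have V: "finite ?V" "card ?V = 2 * m + 1" using assms by simp_all
  obtain P where P_mod: "\<And>j. P (j mod L) = P j"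
    and P_bij: "bij_betw (\<lambda>j. map (\<lambda>b. P (j + b)) [0..<m]) {..<L} (pair_seqs ?V m)"
    using universal_cycle_pair_seqs[OF V assms(2)] unfolding L_def by blast
  have factL: "fact n = L * 2 ^ m"
    using card_pair_seqs[OF V(1), of m] V(2) assms(1) by (simp add: L_def)
  have m: "m = Suc q" using assms(2) by (simp add: q_def)
  have fact2: "fact n div 2 = C" and factm: "fact n div 2 ^ m = L" and fact2C: "fact n = 2 * C"
    by (simp_all add: factL C_def m)
  have "L \<noteq> 0" using factL by (metis fact_nonzero mult_0)
  then have L0: "L > 0" by simp
  then have C0: "C > 0" by (simp add: C_def)
  have "fact m * 2 ^ m dvd L * 2 ^ m"
    using fact_mult_power_two_dvd[of m] factL assms(1) by simp
  then have fact_dvd: "fact m dvd L" by simp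
  have qL: "q dvd L" if "q > 0"
    using fact_dvd dvd_fact[of q m] that m by (auto intro: dvd_trans)
  have evenL: "even L" if "q > 0"
    using fact_dvd dvd_fact[of 2 m] that m by (auto intro: dvd_trans)
  have P_modC: "P (j mod C) = P j" for j
    using P_mod[of j] P_mod[of "j mod C"] by (simp add: C_def mod_mod_cancel)
  have P_win: "map (\<lambda>b. P (j + b)) [0..<m] \<in> pair_seqs ?V m" for j
  proof -
    have "P (j mod L + b) = P (j + b)" for b
      using P_mod[of "j mod L + b"] P_mod[of "j + b"] by (simp add: mod_add_left_eq)
    then show ?thesis
      using bij_betw_apply[OF P_bij, of "j mod L"] L0 by simp
  qed
  have P_sub: "P j \<subseteq> ?V" and P_card: "card (P j) = 2" for j
  proof -
    have "P j \<in> set (map (\<lambda>b. P (j + b)) [0..<m])"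
      using assms(2) by (auto intro!: image_eqI[of _ _ 0])
    then show "P j \<subseteq> ?V" "card (P j) = 2"
      using P_win[of j] unfolding pair_seqs_def by blast+
  qed
  \<comment> \<open>Column \<open>j\<close> holds the two symbols of \<open>P j\<close>; an odd
    number of changes swaps them.\<close>
  define T where "T i j = (if even (orient q L j + i) then Min (P j) else Max (P j))" for i j
  have T_col: "{T i j, T (Suc i mod 2) j} = P j" if "i < 2" for i j
    using card_two_Min_Max(2)[OF P_card[of j]] that
    by (auto simp: T_def less_2_cases_iff)
  have T_parity: "even (orient q L j + i) \<longleftrightarrow> even (orient q L j' + i')"
    if "P j = P j'" "T i j = T i' j'" for i j i' j'
    using card_two_Min_Max(1)[OF P_card[of j]] card_two_Min_Max(1)[OF P_card[of j']] that
    by (auto simp: T_def split: if_splits)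
  have win: "window 2 C 2 m T i j = map (\<lambda>b. T i ((j + b) mod C)) [0..<m] @
      map (\<lambda>b. T (Suc i mod 2) ((j + b) mod C)) [0..<m]" if "i < 2" for i j
    using that by (simp add: window_def numeral_2_eq_2)
  have win_set: "set (window 2 C 2 m T i j) = \<Union>(set (map (\<lambda>b. P (j + b)) [0..<m]))" if "i < 2" for i j
  proof -
    have "set (window 2 C 2 m T i j) = (\<Union>b<m. {T i ((j + b) mod C), T (Suc i mod 2) ((j + b) mod C)})"
      using that by (auto simp: win)
    then show ?thesis using that by (simp add: T_col P_modC atLeast0LessThan)
  qed
  have win_in: "window 2 C 2 m T i j \<in> shorthand_perms n" if "i < 2" for i j
  proof -
    have len: "length (window 2 C 2 m T i j) = 2 * m" using that by (simp add: win)
    then have "distinct (window 2 C 2 m T i j)"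
      using card_Union_pair_seqs[OF P_win V(1), of j] win_set[OF that, of j] by (intro card_distinct) simp
    moreover have "set (window 2 C 2 m T i j) \<subseteq> ?V"
      unfolding win_set[OF that] by (rule Union_pair_seqs[OF P_win])
    ultimately show ?thesis using len assms(1) by (simp add: shorthand_perms_def)
  qed
  have inj: "i = i' \<and> j = j'"
    if i: "i < 2" "i' < 2" and j: "j < C" "j' < C"
      and eq: "window 2 C 2 m T i j = window 2 C 2 m T i' j'" for i i' j j'
  proof -
    have T0: "T i ((j + b) mod C) = T i' ((j' + b) mod C)"
      and T1: "T (Suc i mod 2) ((j + b) mod C) = T (Suc i' mod 2) ((j' + b) mod C)"
      if "b < m" for b
      using eq that i by (simp_all add: win)
    have PP: "P (j + b) = P (j' + b)" if "b < m" for b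
      using T0[OF that] T1[OF that] T_col[OF i(1), of "(j + b) mod C"] T_col[OF i(2), of "(j' + b) mod C"]
      by (simp add: P_modC)
    have Pm: "P (x mod L + b) = P (x + b)" for x b
      using P_mod[of "x mod L + b"] P_mod[of "x + b"] by (simp add: mod_add_left_eq)
    have "map (\<lambda>b. P (j mod L + b)) [0..<m] = map (\<lambda>b. P (j' mod L + b)) [0..<m]"
      using PP by (simp add: Pm)
    \<comment> \<open>The unordered pairs alone fix the position within a copy; the orientations
      must then identify the copy and the starting row.\<close>
    then have t: "j mod L = j' mod L"
      by (rule inj_onD[OF bij_betw_imp_inj_on[OF P_bij]]) (simp_all add: L0)
    have par: "even (orient q L ((j + b) mod C) + i) \<longleftrightarrow> even (orient q L ((j' + b) mod C) + i')"
      if "b < m" for b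
      using T_parity[OF _ T0[OF that]] PP[OF that] by (simp add: P_modC)
    have kk: "j div L < 2 ^ q" "j' div L < 2 ^ q"
      using j by (simp_all add: C_def less_mult_imp_div_less)
    have "j div L = j' div L"
    proof (cases "q = 0")
      case True
      then show ?thesis using kk by simp
    next
      case False
      then have q: "q > 0" by simp
      have par': "even (orient q L (j + b) + i) \<longleftrightarrow> even (orient q L (j' + b) + i')" if "b < m" for b
        using par[OF that] even_orient_mod[OF q qL[OF q] L0 evenL[OF q]] by (simp add: C_def)
      \<comment> \<open>Comparing \<open>par'\<close> at \<open>b\<close> and \<open>Suc b\<close>
        cancels the starting rows and the earlier changes, so \<open>m\<close> columns yield
        \<open>q = m - 1\<close> digits.\<close>
      have fl: "flip q L (j + b) \<longleftrightarrow> flip q L (j' + b)" if "b < q" for b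
        using par'[of b] par'[of "Suc b"] that m by (auto simp: orient_def)
      have split: "j div L * L + j mod L = j" "j' div L * L + j mod L = j'"
        by (rule div_mult_mod_eq) (simp only: t div_mult_mod_eq)
      show ?thesis
        by (rule flip_window_inj[OF q qL[OF q] _ kk, of "j mod L"])
          (use L0 fl in \<open>simp_all only: split mod_less_divisor\<close>)
    qed
    then have jj: "j = j'" using t by (metis div_mult_mod_eq)
    \<comment> \<open>With equal columns, the parity at offset 0 fixes the starting row.\<close>
    moreover have "i = i'"
      using par[of 0] i m jj by (auto simp: less_2_cases_iff)
    ultimately show ?thesis by simp
  qed
  let ?D = "{..<2 :: nat} \<times> {..<C}"
  let ?W = "\<lambda>p. window 2 C 2 m T (fst p) (snd p)"
  have W_inj: "inj_on ?W ?D"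
    by (rule inj_onI) (use inj in \<open>auto simp: prod_eq_iff\<close>)
  \<comment> \<open>Injectivity suffices: there are \<open>2 * C = n!\<close> windows and as many
    words.\<close>
  have W_img: "?W ` ?D = shorthand_perms n"
  proof (rule card_subset_eq)
    show "finite (shorthand_perms n)"
      unfolding shorthand_perms_def by (rule finite_subset[OF _ finite_lists_length_eq[OF V(1), of "n - 1"]]) auto
    show "?W ` ?D \<subseteq> shorthand_perms n" using win_in by auto
    show "card (?W ` ?D) = card (shorthand_perms n)"
      using card_image[OF W_inj] card_shorthand_perms[of n] assms(1) fact2C by (simp add: card_cartesian_product)
  qed
  have T_less: "T i j < n" for i j
  proof -
    have "T i j \<in> P j"
      using card_two_Min_Max(2)[OF P_card[of j]] by (auto simp: T_def)
    with P_sub show ?thesis by auto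
  qed
  have "shorthand_universal_torus n 2 C 2 m T"
    unfolding shorthand_universal_torus_def
  proof (intro conjI ballI)
    fix w assume "w \<in> shorthand_perms n"
    then obtain p where p: "p \<in> ?D" "?W p = w" using W_img by (metis (no_types, lifting) imageE)
    show "\<exists>!p. p \<in> ?D \<and> ?W p = w"
    proof (rule ex1I[of _ p])
      show "p' = p" if p': "p' \<in> ?D \<and> ?W p' = w" for p'
        by (rule inj_onD[OF W_inj]) (simp_all only: p p')
    qed (use p in simp)
  qed (use fact2C T_less assms(1) in auto)
  moreover have "partitions_into_matching_blocks 2 C (2 ^ (m - 1)) L T"
  proof -
    \<comment> \<open>Orientation does not affect the value set of a column, so the columns inherit
      the period \<open>L\<close> of \<open>P\<close>.\<close>
    have col: "(\<lambda>i. T i j) ` {..<2} = P j" for j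
      using T_col[of 0 j] by (simp add: numeral_2_eq_2 lessThan_Suc insert_commute)
    have shift: "P (x * L + t) = P t" for x t
      using P_mod[of "x * L + t"] P_mod[of t] by simp
    show ?thesis
      unfolding q_def[symmetric]
      by (simp add: partitions_into_matching_blocks_def blocks_match_def columns_match_def col P_modC
          shift flip: C_def)
  qed
  ultimately show ?thesis unfolding fact2 factm by blast
qed

end
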